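(* Under external placement, the Collect-based Causal Monitor algorithm is sound for the Causal Observability Problem: in every execution and for all operations $\mathit{op}_A,\mathit{op}_B$ (with identifiers $A,B$), $$\mathrm{Precedes}(A,B)=\mathtt{true}\;\Rightarrow\;\mathit{op}_A<_H\mathit{op}_B .$$
   Context: **Model.** $N$ asynchronous processes $p_1,\dots,p_N$ communicate through atomic shared memory. $e\prec f$ means event $e$ occurs before event $f$ in real time; no two events are simultaneous. Operations $\mathit{op}$ of a target algorithm, each with a unique identifier, are executed by the processes; $\mathrm{inv}(\mathit{op})$ and $\mathrm{res}(\mathit{op})$ are their invocation and response events. $\mathit{op}_A<_H\mathit{op}_B$ iff $\mathrm{res}(\mathit{op}_A)\prec\mathrm{inv}(\mathit{op}_B)$. **External placement.** The process executing $\mathit{op}$ with identifier $\mathit{id}$ calls $\mathrm{Add\_Inv}(\mathit{id})$, and this call returns before $\mathrm{inv}(\mathit{op})$; it calls $\mathrm{Add\_Res}(\mathit{id})$ after $\mathrm{res}(\mathit{op})$. $\mathrm{Precedes}(A,B)$ is queried only when the response records of both $A$ and $B$ have been written. **Collect-based algorithm.** Shared: single-writer multi-reader append-only registers $\mathrm{Reg}[1..N]$ holding sequences of records ($\mathrm{Reg}[i]$ written only by $p_i$), initially empty. - $\mathrm{Add\_Inv}(\mathit{id})$ by $p_i$: append $(I,\mathit{id})$ to $\mathrm{Reg}[i]$ in one atomic write. - $\mathrm{Add\_Res}(\mathit{id})$ by $p_i$: perform a collect, i.e. read all registers $\mathrm{Reg}[1],\dots,\mathrm{Reg}[N]$ one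 at a time (each read atomic, the whole non-atomic, in no particular prescribed order), and let the view $v$ be the union of the sets of records read; then append $(R,\mathit{id},v)$ to $\mathrm{Reg}[i]$ in one atomic write. - $\mathrm{Precedes}(A,B)$: let $v_A,v_B$ be the views stored with the response records of $A$ and $B$; return the conjunction of $(R,A)\in v_B$, $(I,B)\notin v_A$, and $v_A\subseteq v_B$. Here $(R,A)\in v_B$ means that $v_B$ contains the response record of $A$. *)

theory Defs
  imports Main "HOL-Library.FSet" "HOL-Library.Extended_Nat"
begin

text \<open>
  Operations are represented by their unique identifiers, of type \<open>'id\<close>; a function
  \<open>owner :: 'id \<Rightarrow> 'p\<close> gives the process that executes an operation and makes the monitor
  calls for it. The finite type \<open>'p\<close> is the set of the \<open>N\<close> processes, and also indexes
  their registers.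
\<close>

datatype 'id entry =
    Inv_Rec 'id
  | Res_Rec 'id "'id entry fset"

datatype op_status = Op_Idle | Op_Running | Op_Done

datatype inv_status = AI_Idle | AI_Called | AI_Written | AI_Returned

text \<open>
  \<open>AR_Collecting S v\<close>: the registers read so far by the collect are those in \<open>S\<close>, and
  \<open>v\<close> is the union of the records read from them.
\<close>

datatype ('p, 'id) res_status =
    AR_Idle
  | AR_Collecting "'p set" "'id entry fset"
  | AR_Written
  | AR_Returned

record ('p, 'id) config =
  reg :: "'p \<Rightarrow> 'id entry list"
  op_st :: "'id \<Rightarrow> op_status"
  inv_st :: "'id \<Rightarrow> inv_status"
  res_st :: "'id \<Rightarrow> ('p, 'id) res_status"

definition init_config :: "('p, 'id) config" where
  "init_config = \<lparr> reg = (\<lambda>_. []), op_st = (\<lambda>_. Op_Idle),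
     inv_st = (\<lambda>_. AI_Idle), res_st = (\<lambda>_. AR_Idle) \<rparr>"

definition written :: "('p, 'id) config \<Rightarrow> 'id entry set" where
  "written c = (\<Union>i. set (reg c i))"

definition response_written :: "('p, 'id) config \<Rightarrow> 'id \<Rightarrow> bool" where
  "response_written c a \<longleftrightarrow> (\<exists>v. Res_Rec a v \<in> written c)"

text \<open>
  Meaningful once the response record of \<open>a\<close> has been written; a second one is never
  written, because \<open>step\<close> lets \<open>Add_Res(a)\<close> be called only once.
\<close>

definition view_of :: "('p, 'id) config \<Rightarrow> 'id \<Rightarrow> 'id entry fset" where
  "view_of c a = (THE v. Res_Rec a v \<in> written c)"

definition precedes_value :: "('p, 'id) config \<Rightarrow> 'id \<Rightarrow> 'id \<Rightarrow> bool" where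
  "precedes_value c a b \<longleftrightarrow>
     (let va = view_of c a; vb = view_of c b in
        (\<exists>v. Res_Rec a v |\<in>| vb) \<and> Inv_Rec b |\<notin>| va \<and> va |\<subseteq>| vb)"

text \<open>
  \<open>Inv\<close> and \<open>Res\<close> are the invocation and response events of the target algorithm.
  \<open>Precedes a b r\<close> is a query of \<open>Precedes(a, b)\<close> that returns \<open>r\<close>.
\<close>

datatype ('p, 'id) event =
    Inv 'id
  | Res 'id
  | Add_Inv_Call 'id
  | Add_Inv_Write 'id
  | Add_Inv_Ret 'id
  | Add_Res_Call 'id
  | Add_Res_Read 'id 'p
  | Add_Res_Write 'id
  | Add_Res_Ret 'id
  | Precedes 'id 'id bool

text \<open>
  The rules \<open>inv\<close> and \<open>res\<close> do not refer to the state of the monitor calls, and vice versa: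
  how the two are placed relative to each other is left to \<open>external_placement\<close> below.
  Monitor calls and operations of the same process are not required to be sequential.
\<close>

inductive step ::
  "('id \<Rightarrow> 'p) \<Rightarrow> ('p, 'id) config \<Rightarrow> ('p, 'id) event \<Rightarrow> ('p, 'id) config \<Rightarrow> bool"
  for owner :: "'id \<Rightarrow> 'p"
where
  inv: "op_st c a = Op_Idle \<Longrightarrow>
    step owner c (Inv a) (c\<lparr>op_st := (op_st c)(a := Op_Running)\<rparr>)"
| res: "op_st c a = Op_Running \<Longrightarrow>
    step owner c (Res a) (c\<lparr>op_st := (op_st c)(a := Op_Done)\<rparr>)"
| add_inv_call: "inv_st c a = AI_Idle \<Longrightarrow>
    step owner c (Add_Inv_Call a) (c\<lparr>inv_st := (inv_st c)(a := AI_Called)\<rparr>)"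
| add_inv_write: "inv_st c a = AI_Called \<Longrightarrow>
    step owner c (Add_Inv_Write a)
      (c\<lparr>reg := (reg c)(owner a := reg c (owner a) @ [Inv_Rec a]),
         inv_st := (inv_st c)(a := AI_Written)\<rparr>)"
| add_inv_ret: "inv_st c a = AI_Written \<Longrightarrow>
    step owner c (Add_Inv_Ret a) (c\<lparr>inv_st := (inv_st c)(a := AI_Returned)\<rparr>)"
| add_res_call: "res_st c a = AR_Idle \<Longrightarrow>
    step owner c (Add_Res_Call a) (c\<lparr>res_st := (res_st c)(a := AR_Collecting {} {||})\<rparr>)"
| add_res_read: "res_st c a = AR_Collecting S v \<Longrightarrow> j \<notin> S \<Longrightarrow>
    step owner c (Add_Res_Read a j)
      (c\<lparr>res_st := (res_st c)
           (a := AR_Collecting (insert j S) (v |\<union>| fset_of_list (reg c j)))\<rparr>)"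
| add_res_write: "res_st c a = AR_Collecting UNIV v \<Longrightarrow>
    step owner c (Add_Res_Write a)
      (c\<lparr>reg := (reg c)(owner a := reg c (owner a) @ [Res_Rec a v]),
         res_st := (res_st c)(a := AR_Written)\<rparr>)"
| add_res_ret: "res_st c a = AR_Written \<Longrightarrow>
    step owner c (Add_Res_Ret a) (c\<lparr>res_st := (res_st c)(a := AR_Returned)\<rparr>)"
| precedes: "r = precedes_value c a b \<Longrightarrow> step owner c (Precedes a b r) c"

text \<open>
  A finite or infinite execution: \<open>ev E t\<close> is the event at time \<open>t\<close>, for \<open>t\<close> smaller than
  \<open>duration E\<close>, and \<open>conf E t\<close> is the configuration immediately before it.
\<close>

record ('p, 'id) run =
  duration :: enat
  ev :: "nat \<Rightarrow> ('p, 'id) event"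
  conf :: "nat \<Rightarrow> ('p, 'id) config"

definition execution :: "('id \<Rightarrow> 'p) \<Rightarrow> ('p, 'id) run \<Rightarrow> bool" where
  "execution owner E \<longleftrightarrow> conf E 0 = init_config \<and>
     (\<forall>t. enat t < duration E \<longrightarrow> step owner (conf E t) (ev E t) (conf E (Suc t)))"

definition occurs_at :: "('p, 'id) run \<Rightarrow> ('p, 'id) event \<Rightarrow> nat \<Rightarrow> bool" where
  "occurs_at E e t \<longleftrightarrow> enat t < duration E \<and> ev E t = e"

definition op_before :: "('p, 'id) run \<Rightarrow> 'id \<Rightarrow> 'id \<Rightarrow> bool" where
  "op_before E a b \<longleftrightarrow> (\<exists>s t. occurs_at E (Res a) s \<and> occurs_at E (Inv b) t \<and> s < t)"

definition external_placement :: "('p, 'id) run \<Rightarrow> bool" where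
  "external_placement E \<longleftrightarrow>
     (\<forall>a t. occurs_at E (Inv a) t \<longrightarrow> (\<exists>s<t. occurs_at E (Add_Inv_Ret a) s)) \<and>
     (\<forall>a t. occurs_at E (Add_Res_Call a) t \<longrightarrow> (\<exists>s<t. occurs_at E (Res a) s)) \<and>
     (\<forall>a b r t. occurs_at E (Precedes a b r) t \<longrightarrow>
        response_written (conf E t) a \<and> response_written (conf E t) b)"

end

theory Submission
  imports Defs
begin

text \<open>
  Only the conjunct \<open>Inv_Rec B \<notin> v\<^sub>A\<close> of the query matters. Consider the moment at which \<open>B\<close> is
  invoked: by external placement the record \<open>Inv_Rec B\<close> already lies in its register, and
  registers only grow. If \<open>A\<close> had not responded by then, its collect would lie entirely in
  the future, so it would read \<open>Inv_Rec B\<close>. Hence \<open>A\<close> has responded before \<open>B\<close> is invoked.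
\<close>

text \<open>Starting at an arbitrary time \<open>m\<close> lets a property that is true only from
  some event onwards be propagated from that event. The bound on \<open>n\<close> is non-strict, so
  the configuration after the last event of a finite run is covered.\<close>

lemma execution_induct [consumes 3, case_names base step]:
  assumes "execution owner E" "enat n \<le> duration E" "m \<le> n"
    and "P m"
    and "\<And>k. m \<le> k \<Longrightarrow> occurs_at E (ev E k) k \<Longrightarrow>
      step owner (conf E k) (ev E k) (conf E (Suc k)) \<Longrightarrow> P k \<Longrightarrow> P (Suc k)"
  shows "P n"
  using assms(3,2)
proof (induction n rule: dec_induct)
  case base
  show ?case by (fact assms(4))
next
  case (step k)
  then have "enat k < duration E"
    using Suc_ile_eq by blast
  with step assms(1,5) show ?case
    by (auto simp: execution_def occurs_at_def)
qed

lemma execution_step: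
  "execution owner E \<Longrightarrow> occurs_at E e t \<Longrightarrow> step owner (conf E t) e (conf E (Suc t))"
  by (auto simp: execution_def occurs_at_def)

lemma external_placementD:
  assumes "external_placement E"
  shows "occurs_at E (Inv a) t \<Longrightarrow> \<exists>s<t. occurs_at E (Add_Inv_Ret a) s"
    and "occurs_at E (Add_Res_Call a) t \<Longrightarrow> \<exists>s<t. occurs_at E (Res a) s"
    and "occurs_at E (Precedes a b r) t \<Longrightarrow>
      response_written (conf E t) a \<and> response_written (conf E t) b"
  using assms by (simp_all add: external_placement_def)

lemma occurs_at_le_duration:
  assumes "occurs_at E e t" "s \<le> Suc t"
  shows "enat s \<le> duration E"
proof -
  have "enat (Suc t) \<le> duration E"
    using assms(1) by (simp add: occurs_at_def Suc_ile_eq)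
  with assms(2) show ?thesis
    by (meson enat_ord_simps(1) order_trans)
qed

text \<open>The third clause makes the \<open>THE\<close> in \<open>view_of\<close> well defined;
  the second is the strengthening that makes the third inductive.\<close>

definition records_consistent :: "('id \<Rightarrow> 'p) \<Rightarrow> ('p, 'id) config \<Rightarrow> bool" where
  "records_consistent owner c \<longleftrightarrow>
     (\<forall>a. inv_st c a \<in> {AI_Written, AI_Returned} \<longrightarrow> Inv_Rec a \<in> set (reg c (owner a))) \<and>
     (\<forall>a v. Res_Rec a v \<in> written c \<longrightarrow> res_st c a \<in> {AR_Written, AR_Returned}) \<and>
     (\<forall>a v w. Res_Rec a v \<in> written c \<longrightarrow> Res_Rec a w \<in> written c \<longrightarrow> v = w)"

lemma written_append:
  "written (c\<lparr>reg := (reg c)(i := reg c i @ [x])\<rparr>) = insert x (written c)"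
  by (auto simp: written_def split: if_splits)

lemma written_update:
  "written (c\<lparr>op_st := f\<rparr>) = written c"
  "written (c\<lparr>inv_st := g\<rparr>) = written c"
  "written (c\<lparr>res_st := h\<rparr>) = written c"
  by (simp_all add: written_def)

lemma records_consistent_step:
  assumes "step owner c e c'" "records_consistent owner c"
  shows "records_consistent owner c'"
  using assms(1)
proof cases
  case (add_res_write a v)
  \<comment> \<open>The guard of this write demands a state \<open>AR_Collecting\<close>, which the
    second clause of the invariant forbids once a response record of \<open>a\<close>
    exists.\<close>
  then have "Res_Rec a w \<notin> written c" for w
    using assms(2) by (force simp: records_consistent_def)
  with add_res_write assms(2) show ?thesis
    by (auto simp: records_consistent_def written_append written_update)
qed (use assms(2) in \<open>auto simp: records_consistent_def written_append written_update\<close>)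

lemma records_consistent_conf:
  assumes "execution owner E" "enat n \<le> duration E"
  shows "records_consistent owner (conf E n)"
  using assms le0
proof (induction rule: execution_induct)
  case base
  then show ?case
    using assms(1)
    by (simp add: execution_def init_config_def records_consistent_def written_def)
qed (rule records_consistent_step)

lemma view_of_eq:
  assumes "records_consistent owner c" "Res_Rec a v \<in> written c"
  shows "view_of c a = v"
  unfolding view_of_def
proof (rule the_equality)
  show "w = v" if "Res_Rec a w \<in> written c" for w
    using assms that by (auto simp: records_consistent_def)
qed (fact assms(2))

lemma inv_st_Returned_step:
  "step owner c e c' \<Longrightarrow> inv_st c a = AI_Returned \<Longrightarrow> inv_st c' a = AI_Returned"
  by (induction rule: step.induct) auto

lemma op_st_Done_step:
  "step owner c e c' \<Longrightarrow> op_st c a = Op_Done \<Longrightarrow> op_st c' a = Op_Done"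
  by (induction rule: step.induct) auto

lemma inv_st_after_Add_Inv_Ret:
  assumes "execution owner E" "occurs_at E (Add_Inv_Ret a) s" "s < n" "enat n \<le> duration E"
  shows "inv_st (conf E n) a = AI_Returned"
  \<comment> \<open>The induction starts at \<open>Suc s\<close>, the configuration right after the
    event.\<close>
  using assms(1,4) Suc_leI[OF assms(3)]
proof (induction rule: execution_induct)
  case base
  show ?case
    using execution_step[OF assms(1,2)] by cases auto
qed (rule inv_st_Returned_step)

lemma op_st_after_Res:
  assumes "execution owner E" "occurs_at E (Res a) s" "s < n" "enat n \<le> duration E"
  shows "op_st (conf E n) a = Op_Done"
  using assms(1,4) Suc_leI[OF assms(3)]
proof (induction rule: execution_induct)
  case base
  show ?case
    using execution_step[OF assms(1,2)] by cases auto
qed (rule op_st_Done_step)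

lemma Inv_occurred:
  assumes "execution owner E" "enat n \<le> duration E" "op_st (conf E n) a \<noteq> Op_Idle"
  shows "\<exists>s<n. occurs_at E (Inv a) s"
proof -
  have "op_st (conf E n) a \<noteq> Op_Idle \<longrightarrow> (\<exists>s<n. occurs_at E (Inv a) s)"
    using assms(1,2) le0
  proof (induction rule: execution_induct)
    case base
    show ?case
      using assms(1) by (simp add: execution_def init_config_def)
  next
    case (step k)
    from step(3,2,4) show ?case
      by cases (auto simp: less_Suc_eq)
  qed
  with assms(3) show ?thesis by blast
qed

lemma Res_occurred:
  assumes "execution owner E" "enat n \<le> duration E" "op_st (conf E n) a = Op_Done"
  shows "\<exists>s<n. occurs_at E (Res a) s"
proof -
  have "op_st (conf E n) a = Op_Done \<longrightarrow> (\<exists>s<n. occurs_at E (Res a) s)"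
    using assms(1,2) le0
  proof (induction rule: execution_induct)
    case base
    show ?case
      using assms(1) by (simp add: execution_def init_config_def)
  next
    case (step k)
    from step(3,2,4) show ?case
      by cases (auto simp: less_Suc_eq split: if_splits)
  qed
  with assms(3) show ?thesis by blast
qed

text \<open>Only the call event leaves \<open>AR_Idle\<close>. External placement puts it after the
  response of \<open>a\<close>, and \<open>Op_Done\<close> is never left.\<close>

lemma op_Done_if_Add_Res_called:
  assumes "execution owner E" "external_placement E" "enat n \<le> duration E"
    and "res_st (conf E n) a \<noteq> AR_Idle"
  shows "op_st (conf E n) a = Op_Done"
proof -
  have "res_st (conf E n) a \<noteq> AR_Idle \<longrightarrow> op_st (conf E n) a = Op_Done"
    using assms(1,3) le0
  proof (induction rule: execution_induct)
    case base
    show ?case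
      using assms(1) by (simp add: execution_def init_config_def)
  next
    case (step k)
    have "op_st (conf E k) a = Op_Done" if call: "ev E k = Add_Res_Call a"
    proof -
      obtain s where "s < k" "occurs_at E (Res a) s"
        using external_placementD(2)[OF assms(2) step(2)[unfolded call]] by blast
      then show ?thesis
        using op_st_after_Res[OF assms(1)] occurs_at_le_duration[OF step(2)] by simp
    qed
    with step(3,4) show ?case
      by cases (auto split: if_splits)
  qed
  with assms(4) show ?thesis by blast
qed

text \<open>An invariant that follows \<open>Inv_Rec b\<close> from its register, through the
  partial collect of \<open>a\<close>, into the stored view.\<close>

definition collects_inv :: "('id \<Rightarrow> 'p) \<Rightarrow> 'id \<Rightarrow> 'id \<Rightarrow> ('p, 'id) config \<Rightarrow> bool" where
  "collects_inv owner a b c \<longleftrightarrow>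
     Inv_Rec b \<in> set (reg c (owner b)) \<and>
     (\<forall>S v. res_st c a = AR_Collecting S v \<longrightarrow> owner b \<in> S \<longrightarrow> Inv_Rec b |\<in>| v) \<and>
     (\<forall>v. Res_Rec a v \<in> written c \<longrightarrow> Inv_Rec b |\<in>| v)"

text \<open>Registers only grow, so reading \<open>owner b\<close> picks up the record. A response
  is written only with \<open>S = UNIV\<close>, which contains \<open>owner b\<close>, so the middle
  clause then yields the last one.\<close>

lemma collects_inv_step:
  "step owner c e c' \<Longrightarrow> collects_inv owner a b c \<Longrightarrow> collects_inv owner a b c'"
  by (induction rule: step.induct)
    (auto simp: collects_inv_def written_append written_update fset_of_list_elem)

theorem theorem16:
  fixes owner :: "'id \<Rightarrow> 'p::finite"
    and E :: "('p, 'id) run"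
    and A B :: 'id
    and t :: nat
  assumes "execution owner E"
    and "external_placement E"
    and "occurs_at E (Precedes A B True) t"
  shows "op_before E A B"
proof -
  note le_duration = occurs_at_le_duration[OF assms(3)]
  have consistent: "records_consistent owner (conf E n)" if "n \<le> t" for n
    using records_consistent_conf[OF assms(1)] le_duration that by simp
  obtain vA vB where vA: "Res_Rec A vA \<in> written (conf E t)"
    and vB: "Res_Rec B vB \<in> written (conf E t)"
    using external_placementD(3)[OF assms(2,3)] by (auto simp: response_written_def)
  \<comment> \<open>That \<open>B\<close> was invoked at all is traced back from its response
    record: \<open>Add_Res\<close> was called, hence \<open>B\<close> has responded, hence it was
    invoked.\<close>
  have "res_st (conf E t) B \<noteq> AR_Idle"
    using consistent[of t] vB unfolding records_consistent_def by force
  then have "op_st (conf E t) B = Op_Done"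
    using op_Done_if_Add_Res_called[OF assms(1,2)] le_duration by simp
  then obtain u where u: "u < t" "occurs_at E (Inv B) u"
    using Inv_occurred[OF assms(1), of t B] le_duration[of t] by auto
  obtain s where "s < u" "occurs_at E (Add_Inv_Ret B) s"
    using external_placementD(1)[OF assms(2) u(2)] by blast
  then have "inv_st (conf E u) B = AI_Returned"
    using inv_st_after_Add_Inv_Ret[OF assms(1)] le_duration u(1) by simp
  then have inv_B: "Inv_Rec B \<in> set (reg (conf E u) (owner B))"
    using consistent[of u] u(1) by (simp add: records_consistent_def)
  have "op_st (conf E u) A = Op_Done"
  proof (rule ccontr)
    assume "op_st (conf E u) A \<noteq> Op_Done"
    then have idle: "res_st (conf E u) A = AR_Idle"
      using op_Done_if_Add_Res_called[OF assms(1,2), of u A] le_duration[of u] u(1) by auto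
    have "collects_inv owner A B (conf E t)"
      using assms(1) le_duration[OF le_SucI[OF order_refl]] less_imp_le[OF u(1)]
    proof (induction rule: execution_induct)
      case base
      \<comment> \<open>At time \<open>u\<close> the last two clauses of \<open>collects_inv\<close>
        hold vacuously: with \<open>A\<close> still at \<open>AR_Idle\<close> there is neither a
        collect in progress nor, by consistency, a response record.\<close>
      show ?case
        using consistent[of u] u(1) inv_B idle
        by (fastforce simp: collects_inv_def records_consistent_def)
    qed (rule collects_inv_step)
    then have "Inv_Rec B |\<in>| view_of (conf E t) A"
      using vA view_of_eq[OF consistent[OF order_refl] vA] by (simp add: collects_inv_def)
    moreover have "precedes_value (conf E t) A B"
      using execution_step[OF assms(1,3)] by cases simp
    ultimately show False
      by (simp add: precedes_value_def Let_def)
  qed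
  then obtain r where "r < u" "occurs_at E (Res A) r"
    using Res_occurred[OF assms(1), of u A] le_duration[of u] u(1) by auto
  with u(2) show ?thesis
    unfolding op_before_def by blast
qed

end
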